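(* Let $\alpha,\beta\ge 0$, and let $\varphi(z)=1+B_1z+B_2z^2+\cdots$ and $\psi(z)=1+D_1z+D_2z^2+\cdots$ be analytic functions on $\mathbb{D}$ with $B_1>0$, $D_1>0$ and $B_2,D_2\in\mathbb{R}$. Let $f(z)=z+\sum_{n=2}^{\infty}a_nz^n$ be bi-univalent in $\mathbb{D}$ and let $g=f^{-1}$. If $f\in\mathcal{P}(\alpha,\varphi)$ and $g\in\mathcal{M}(\beta,\psi)$, then, with $\sigma:=2+7\alpha+3\beta+11\alpha\beta$, $$|a_2|\le \frac{B_1D_1\sqrt{B_1(1+2\beta)+D_1(1+3\alpha)}}{\sqrt{\left|\sigma B_1^2D_1^2-(1+2\alpha)^2(1+2\beta)(B_2-B_1)D_1^2-(1+\beta)^2(1+3\alpha)(D_2-D_1)B_1^2\right|}}$$ (provided the denominator is nonzero), and $$2\sigma|a_3|\le B_1(3+5\beta)+D_1(1+2\alpha)+(3+5\beta)|B_2-B_1|+\frac{(1+\beta)^2B_1^2|D_2-D_1|}{D_1^2(1+2\alpha)}.$$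
   Context: $\mathbb{D}=\{z\in\mathbb{C}:|z|<1\}$. $\mathcal{S}$ is the class of univalent (injective) analytic functions $f$ on $\mathbb{D}$ with $f(0)=0$, $f'(0)=1$. By the Koebe one-quarter theorem each $f\in\mathcal{S}$ has an inverse $f^{-1}$ defined at least on $|w|<1/4$. A function $f\in\mathcal{S}$ is bi-univalent in $\mathbb{D}$ if both $f$ and $f^{-1}$ are univalent in $\mathbb{D}$, i.e. the local inverse $f^{-1}$ at $0$ extends to a univalent analytic function on $\mathbb{D}$, still denoted $f^{-1}$. Subordination: for analytic $F,G$ on $\mathbb{D}$, $F(z)\prec G(z)$ means there is an analytic $w:\mathbb{D}\to\mathbb{D}$ with $w(0)=0$ and $F(z)=G(w(z))$ on $\mathbb{D}$. For $\alpha\ge0$ and analytic $\varphi:\mathbb{D}\to\mathbb{C}$, $\varphi(z)=1+B_1z+B_2z^2+\cdots$ with $B_1>0$, $B_2\in\mathbb{R}$, $$\mathcal{P}(\alpha,\varphi):=\left\{f\in\mathcal{S}:\ \frac{zf'(z)}{f(z)}+\alpha\frac{z^2f''(z)}{f(z)}\prec\varphi(z)\right\},$$ $$\mathcal{M}(\alpha,\varphi):=\left\{f\in\mathcal{S}:\ (1-\alpha)\frac{zf'(z)}{f(z)}+\alpha\left(1+\frac{zf''(z)}{f'(z)}\right)\prec\varphi(z)\right\}$$ (quotients are given their limiting values at $z=0$). No univalence or positivity of the real part of $\varphi,\psi$ is assumed. *)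

theory Defs
  imports "HOL-Complex_Analysis.Complex_Analysis"
begin

abbreviation unit_disc :: "complex set" where
  "unit_disc \<equiv> ball 0 1"

abbreviation taylor_coeff :: "(complex \<Rightarrow> complex) \<Rightarrow> nat \<Rightarrow> complex" where
  "taylor_coeff f n \<equiv> fps_nth (fps_expansion f 0) n"

definition class_S :: "(complex \<Rightarrow> complex) set" where
  "class_S = {f. f holomorphic_on unit_disc \<and> inj_on f unit_disc \<and> f 0 = 0 \<and> deriv f 0 = 1}"

text \<open>\<open>g\<close> is a univalent analytic function on the disc extending the local inverse of
  \<open>f\<close> at \<open>0\<close>. It suffices to compare the two near \<open>0\<close>: for \<open>f\<close> in
  \<^const>\<open>class_S\<close>, the values of such a \<open>g\<close> on the disc are then unique.\<close>

definition univalent_inverse :: "(complex \<Rightarrow> complex) \<Rightarrow> (complex \<Rightarrow> complex) \<Rightarrow> bool" where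
  "univalent_inverse f g \<longleftrightarrow>
     g holomorphic_on unit_disc \<and> inj_on g unit_disc \<and>
     (\<forall>\<^sub>F w in nhds 0. g w = inv_into unit_disc f w)"

definition bi_univalent :: "(complex \<Rightarrow> complex) \<Rightarrow> bool" where
  "bi_univalent f \<longleftrightarrow> f \<in> class_S \<and> (\<exists>g. univalent_inverse f g)"

definition subordinate :: "(complex \<Rightarrow> complex) \<Rightarrow> (complex \<Rightarrow> complex) \<Rightarrow> bool" where
  "subordinate F G \<longleftrightarrow>
     (\<exists>w. w holomorphic_on unit_disc \<and> w ` unit_disc \<subseteq> unit_disc \<and> w 0 = 0 \<and>
          (\<forall>z\<in>unit_disc. F z = G (w z)))"

definition fill_at_0 :: "(complex \<Rightarrow> complex) \<Rightarrow> complex \<Rightarrow> complex" where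
  "fill_at_0 F z = (if z = 0 then Lim (at 0) F else F z)"

definition class_P :: "real \<Rightarrow> (complex \<Rightarrow> complex) \<Rightarrow> (complex \<Rightarrow> complex) set" where
  "class_P \<alpha> \<phi> = {f \<in> class_S.
     subordinate
       (fill_at_0 (\<lambda>z. z * deriv f z / f z + of_real \<alpha> * (z\<^sup>2 * deriv (deriv f) z / f z)))
       \<phi>}"

definition class_M :: "real \<Rightarrow> (complex \<Rightarrow> complex) \<Rightarrow> (complex \<Rightarrow> complex) set" where
  "class_M \<alpha> \<phi> = {f \<in> class_S.
     subordinate
       (fill_at_0 (\<lambda>z. (1 - of_real \<alpha>) * (z * deriv f z / f z)
                     + of_real \<alpha> * (1 + z * deriv (deriv f) z / deriv f z)))
       \<phi>}"

end

(* Comparing the coefficients of order one and two in the two subordinations gives a linear system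
   relating a_2, a_2^2, a_3 to the first two coefficients u_1, u_2 and v_1, v_2 of the Schwarz
   functions.  Since B_1 u_2 + B_2 u_1^2 = B_1 (u_2 + u_1^2) + (B_2 - B_1) u_1^2, the bounds follow
   by eliminating a_3, respectively a_2^2, and using |u_1| <= 1 and |u_2 + u_1^2| <= 1, the latter
   being a consequence of the Schwarz-Pick inequality |u_2| <= 1 - |u_1|^2. *)
theory Submission
  imports Defs
begin

unbundle no vec_syntax

section \<open>Coefficients of low order in products, derivatives and compositions of power
  series\<close>

lemma fps_mult_nth_2: "(f * g) $ 2 = f $ 0 * g $ 2 + f $ 1 * g $ 1 + f $ 2 * g $ 0"
  for f g :: "'a::comm_semiring_1 fps"
  by (simp add: fps_mult_nth numeral_eq_Suc)

lemma fps_mult_nth_3: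
  "(f * g) $ 3 = f $ 0 * g $ 3 + f $ 1 * g $ 2 + f $ 2 * g $ 1 + f $ 3 * g $ 0"
  for f g :: "'a::comm_semiring_1 fps"
  by (simp add: fps_mult_nth numeral_eq_Suc)

lemma fps_deriv_nth_small:
  fixes F :: "'a::comm_ring_1 fps"
  shows "fps_deriv F $ 0 = F $ 1" "fps_deriv F $ 1 = 2 * F $ 2" "fps_deriv F $ 2 = 3 * F $ 3"
  by (simp_all add: numeral_eq_Suc)

lemma fps_X_mult_nth_small:
  fixes F :: "'a::comm_ring_1 fps"
  shows "(fps_X * F) $ 0 = 0" "(fps_X * F) $ 1 = F $ 0" "(fps_X * F) $ 2 = F $ 1"
    "(fps_X * F) $ 3 = F $ 2"
  by (simp_all add: numeral_eq_Suc)

lemma fps_compose_nth_small: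
  fixes F G :: "'a::comm_ring_1 fps"
  assumes "G $ 0 = 0"
  shows "(F oo G) $ 1 = F $ 1 * G $ 1"
    and "(F oo G) $ 2 = F $ 1 * G $ 2 + F $ 2 * (G $ 1)\<^sup>2"
    and "(F oo G) $ 3 = F $ 1 * G $ 3 + 2 * F $ 2 * G $ 1 * G $ 2 + F $ 3 * (G $ 1) ^ 3"
  using assms by (simp_all add: fps_compose_nth fps_mult_nth numeral_eq_Suc algebra_simps)

lemma holomorphic_unit_disc_has_fps_expansion:
  "f holomorphic_on unit_disc \<Longrightarrow> f has_fps_expansion fps_expansion f 0"
  by (intro has_fps_expansion_fps_expansion[of unit_disc]) auto

lemma fps_expansion_nth_0 [simp]: "taylor_coeff f 0 = f 0"
  and fps_expansion_nth_Suc_0 [simp]: "taylor_coeff f (Suc 0) = deriv f 0"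
  by (simp_all add: fps_expansion_def)

text \<open>An expansion depends only on the germ at 0, and the disc is a neighbourhood of 0. This
  turns a functional identity on the disc into an identity of formal power series, whose
  coefficients can then be compared.\<close>

lemma has_fps_expansion_eqI:
  fixes f g :: "complex \<Rightarrow> complex"
  assumes "\<forall>z\<in>unit_disc. f z = g z" "f has_fps_expansion F" "g has_fps_expansion G"
  shows "F = G"
proof -
  have "\<forall>\<^sub>F z in nhds 0. f z = g z"
    using eventually_nhds_in_open[of unit_disc 0] by (rule eventually_mono) (use assms(1) in auto)
  then show ?thesis
    using assms(2,3) has_fps_expansion_cong fps_expansion_unique_complex by blast
qed

section \<open>The first two coefficients of a Schwarz function\<close>

text \<open>Following \<open>h\<close> by the disc automorphism that sends \<open>h 0\<close> to 0
  gives a self-map \<open>k\<close> of the disc fixing 0. The Schwarz lemma bounds its derivative at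
  0 by 1, and undoing the automorphism produces the factor
  \<open>1 - (norm (h 0))\<^sup>2\<close>.\<close>

lemma Schwarz_Pick_deriv_0:
  assumes h: "h holomorphic_on unit_disc" and lt: "\<And>z. z \<in> unit_disc \<Longrightarrow> norm (h z) < 1"
  shows "norm (deriv h 0) \<le> 1 - (norm (h 0))\<^sup>2"
proof -
  define k where "k = Moebius_function 0 (h 0) \<circ> h"
  have h0: "norm (h 0) < 1"
    using lt by simp
  have k: "k holomorphic_on unit_disc"
    unfolding k_def using h0 lt
    by (intro holomorphic_on_compose_gen[OF h Moebius_function_holomorphic]) auto
  have dk: "norm (deriv k 0) \<le> 1"
    using h0 lt Schwarz_Lemma(2)[OF k, of 0]
    by (simp add: k_def Moebius_function_eq_zero Moebius_function_norm_lt_1)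
  note exps = holomorphic_unit_disc_has_fps_expansion[OF h]
    holomorphic_unit_disc_has_fps_expansion[OF k]
  \<comment> \<open>With the Moebius denominator cleared, the derivative of \<open>k\<close> at 0 is
    read off from the coefficient of order one. Since \<open>k 0 = 0\<close>, only one term of the
    product on the left contributes.\<close>
  have "\<forall>z\<in>unit_disc. k z * (1 - cnj (h 0) * h z) = h z - h 0"
  proof
    fix z :: complex
    assume z: "z \<in> unit_disc"
    have "norm (cnj (h 0) * h z) < 1"
      using h0 lt[OF z] by (metis complex_mod_cnj norm_mult_less mult_1)
    then have "1 - cnj (h 0) * h z \<noteq> 0"
      by auto
    then show "k z * (1 - cnj (h 0) * h z) = h z - h 0"
      by (simp add: k_def Moebius_function_simple)
  qed
  then have "fps_expansion k 0 * (1 - fps_const (cnj (h 0)) * fps_expansion h 0)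
      = fps_expansion h 0 - fps_const (h 0)"
    by (rule has_fps_expansion_eqI) (intro fps_expansion_intros exps)+
  from arg_cong[OF this, of "\<lambda>F. F $ 1"]
  have "deriv h 0 = deriv k 0 * (1 - cnj (h 0) * h 0)"
    by (simp add: k_def Moebius_function_eq_zero)
  also have "1 - cnj (h 0) * h 0 = of_real (1 - (norm (h 0))\<^sup>2)"
    by (metis complex_norm_square mult.commute of_real_1 of_real_diff)
  finally have "norm (deriv h 0) = norm (deriv k 0) * (1 - (norm (h 0))\<^sup>2)"
    using h0 by (simp add: norm_mult abs_square_le_1 del: of_real_diff)
  also have "\<dots> \<le> 1 * (1 - (norm (h 0))\<^sup>2)"
    using dk h0 by (intro mult_right_mono) (simp_all add: abs_square_le_1)
  finally show ?thesis by simp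
qed

text \<open>Write \<open>w z = z * h z\<close>. The coefficients of \<open>w\<close> of order one
  and two are the value and the derivative of \<open>h\<close> at 0, so Schwarz-Pick for
  \<open>h\<close> gives the second bound. It does not apply when \<open>h\<close> reaches modulus 1
  in the disc, but then \<open>w\<close> is a rotation.\<close>

lemma Schwarz_coeff_bounds:
  assumes w: "w holomorphic_on unit_disc" "w ` unit_disc \<subseteq> unit_disc" "w 0 = 0"
  shows "norm (taylor_coeff w 1) \<le> 1"
    and "norm (taylor_coeff w 2) \<le> 1 - (norm (taylor_coeff w 1))\<^sup>2"
proof -
  have lt: "norm (w z) < 1" if "norm z < 1" for z
    using w(2) that by (auto simp: image_subset_iff)
  note Schwarz = Schwarz_Lemma[OF w(1,3) lt]
  show d: "norm (taylor_coeff w 1) \<le> 1"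
    using Schwarz(2)[of 0] by simp
  obtain h where h: "h holomorphic_on unit_disc"
    and wh: "\<And>z. norm z < 1 \<Longrightarrow> w z = z * h z" and dw: "deriv w 0 = h 0"
    using Schwarz3[OF w(1,3)] by metis
  have "fps_expansion w 0 = fps_X * fps_expansion h 0"
    by (rule has_fps_expansion_eqI[where f = w and g = "\<lambda>z. z * h z"])
      (use wh in auto, (intro fps_expansion_intros holomorphic_unit_disc_has_fps_expansion w h)+)
  from arg_cong[OF this, of "\<lambda>F. F $ 2"]
  have w2: "taylor_coeff w 2 = deriv h 0"
    by (simp add: numeral_2_eq_2)
  show "norm (taylor_coeff w 2) \<le> 1 - (norm (taylor_coeff w 1))\<^sup>2"
  proof (cases "\<forall>z\<in>unit_disc. norm (h z) < 1")
    case True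
    then show ?thesis
      using Schwarz_Pick_deriv_0[OF h] w2 dw by simp
  next
    case False
    then obtain z where z: "norm z < 1" "norm (h z) \<ge> 1"
      by force
    \<comment> \<open>Both alternatives are equality cases of the Schwarz lemma. A point with
      \<open>norm (h z) \<ge> 1\<close> gives the first if it is not 0, and the second if it is 0,
      because \<open>deriv w 0 = h 0\<close>.\<close>
    have "(\<exists>z. norm z < 1 \<and> z \<noteq> 0 \<and> norm (w z) = norm z) \<or> norm (deriv w 0) = 1"
    proof (cases "z = 0")
      case True
      then show ?thesis using z d dw by simp
    next
      case False
      have "norm z * norm (h z) \<le> norm z"
        using Schwarz(1)[of z] wh[of z] z(1) by (simp add: norm_mult)
      then have "norm (w z) = norm z"
        using z wh[of z] False by (simp add: norm_mult)
      then show ?thesis using z False by blast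
    qed
    then obtain c where c: "\<And>z. norm z < 1 \<Longrightarrow> w z = c * z" "norm c = 1"
      using Schwarz(3)[of 0] by auto
    \<comment> \<open>For the rotation both sides of the second bound are 0.\<close>
    have "fps_expansion w 0 = fps_const c * fps_X"
      by (rule has_fps_expansion_eqI[where f = w and g = "\<lambda>z. c * z"])
        (use c in auto, (intro fps_expansion_intros holomorphic_unit_disc_has_fps_expansion w)+)
    then show ?thesis
      using c(2) by (simp add: numeral_2_eq_2 norm_mult)
  qed
qed

lemma Schwarz_coeff_sum_bound:
  assumes "w holomorphic_on unit_disc" "w ` unit_disc \<subseteq> unit_disc" "w 0 = 0"
  shows "norm (taylor_coeff w 2 + (taylor_coeff w 1)\<^sup>2) \<le> 1"
  using Schwarz_coeff_bounds(2)[OF assms]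
    norm_triangle_ineq[of "taylor_coeff w 2" "(taylor_coeff w 1)\<^sup>2"]
  by (simp add: norm_power)

section \<open>Coefficient equations from the two subordinations and from the inverse\<close>

lemma class_S_nonzero:
  assumes "f \<in> class_S" "z \<in> unit_disc" "z \<noteq> 0"
  shows "f z \<noteq> 0" "deriv f z \<noteq> 0"
proof -
  show "f z \<noteq> 0"
    using assms inj_onD[of f unit_disc z 0] by (auto simp: class_S_def)
  show "deriv f z \<noteq> 0"
    using assms holomorphic_injective_imp_regular[of f unit_disc z] by (auto simp: class_S_def)
qed

text \<open>Multiplying the subordination by \<open>f z\<close> gives an identity that holds at 0 as
  well, both sides being 0 there, so the limit in \<open>fill_at_0\<close> never has to be computed.
  The factor \<open>f z\<close> has a simple zero at 0 and shifts the order by one: the coefficients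
  of order 2 and 3 give the two equations.\<close>

lemma class_P_coeffs:
  assumes f: "f \<in> class_P \<alpha> \<phi>" and phi: "\<phi> holomorphic_on unit_disc" "\<phi> 0 = 1"
  obtains w where "w holomorphic_on unit_disc" "w ` unit_disc \<subseteq> unit_disc" "w 0 = 0"
    "(1 + 2 * of_real \<alpha>) * taylor_coeff f 2 = taylor_coeff \<phi> 1 * taylor_coeff w 1"
    "2 * (1 + 3 * of_real \<alpha>) * taylor_coeff f 3 - (1 + 2 * of_real \<alpha>) * (taylor_coeff f 2)\<^sup>2
      = taylor_coeff \<phi> 1 * taylor_coeff w 2 + taylor_coeff \<phi> 2 * (taylor_coeff w 1)\<^sup>2"
proof -
  have S: "f \<in> class_S"
    using f by (simp add: class_P_def)
  then have hol: "f holomorphic_on unit_disc" and f0: "f 0 = 0" "deriv f 0 = 1"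
    by (auto simp: class_S_def)
  obtain w where w: "w holomorphic_on unit_disc" "w ` unit_disc \<subseteq> unit_disc" "w 0 = 0"
    and sub: "\<And>z. z \<in> unit_disc \<Longrightarrow>
      fill_at_0 (\<lambda>z. z * deriv f z / f z + of_real \<alpha> * (z\<^sup>2 * deriv (deriv f) z / f z)) z = \<phi> (w z)"
    using f unfolding class_P_def subordinate_def by blast
  note exps = holomorphic_unit_disc_has_fps_expansion
  define F W P where "F = fps_expansion f 0" and "W = fps_expansion w 0"
    and "P = fps_expansion \<phi> 0"
  have W0: "W $ 0 = 0"
    using w by (simp add: W_def)
  \<comment> \<open>The square of \<open>z\<close> is split into two factors \<open>z\<close>, each
    of which becomes one multiplication by \<open>fps_X\<close>.\<close>
  have "\<forall>z\<in>unit_disc. z * deriv f z + of_real \<alpha> * (z * (z * deriv (deriv f) z))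
      = f z * (\<phi> \<circ> w) z"
  proof
    fix z :: complex
    assume z: "z \<in> unit_disc"
    show "z * deriv f z + of_real \<alpha> * (z * (z * deriv (deriv f) z)) = f z * (\<phi> \<circ> w) z"
    proof (cases "z = 0")
      case False
      then show ?thesis
        using sub[OF z] class_S_nonzero[OF S z]
        by (auto simp: fill_at_0_def field_simps power2_eq_square)
    qed (simp add: f0)
  qed
  then have eq: "fps_X * fps_deriv F + fps_const (of_real \<alpha>) * (fps_X * (fps_X * fps_deriv (fps_deriv F)))
      = F * (P oo W)"
    unfolding F_def P_def
    by (rule has_fps_expansion_eqI)
      (intro fps_expansion_intros exps phi hol W0 exps[OF w(1), folded W_def])+
  have c: "F $ 0 = 0" "F $ 1 = 1" "F $ Suc 0 = 1" "P $ 0 = 1" "(P oo W) $ 0 = 1"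
    using f0 phi by (simp_all add: F_def P_def)
  note nth = c fps_deriv_nth_small fps_X_mult_nth_small fps_mult_nth_1 fps_mult_nth_2 fps_mult_nth_3
  have E1: "(1 + 2 * of_real \<alpha>) * F $ 2 = (P oo W) $ 1"
    using arg_cong[OF eq, of "\<lambda>F. F $ 2"]
    by (simp add: nth del: One_nat_def fps_deriv_nth fps_X_mult_nth) (simp add: algebra_simps)
  have E2: "3 * F $ 3 + 6 * of_real \<alpha> * F $ 3 = (P oo W) $ 2 + F $ 2 * (P oo W) $ 1 + F $ 3"
    using arg_cong[OF eq, of "\<lambda>F. F $ 3"]
    by (simp add: nth del: One_nat_def fps_deriv_nth fps_X_mult_nth) algebra
  \<comment> \<open>Replacing \<open>(P oo W) $ 1\<close> by means of \<open>E1\<close> creates the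
    term in the square of \<open>F $ 2\<close>.\<close>
  have "2 * (1 + 3 * of_real \<alpha>) * F $ 3 - (1 + 2 * of_real \<alpha>) * (F $ 2)\<^sup>2 = (P oo W) $ 2"
    using E2 unfolding E1[symmetric] by (simp add: power2_eq_square algebra_simps)
  then show ?thesis
    using that[OF w] E1 fps_compose_nth_small[OF W0, of P] by (simp add: F_def P_def W_def)
qed

text \<open>The method is that of \<open>class_P_coeffs\<close>, but here the denominators are
  cleared by the product of \<open>g z\<close> and \<open>deriv g z\<close>. Since
  \<open>deriv g 0 = 1\<close>, this product also has a simple zero at 0, so orders 2 and 3 are
  again the ones to compare.\<close>

lemma class_M_coeffs:
  assumes g: "g \<in> class_M \<beta> \<psi>" and psi: "\<psi> holomorphic_on unit_disc" "\<psi> 0 = 1"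
  obtains v where "v holomorphic_on unit_disc" "v ` unit_disc \<subseteq> unit_disc" "v 0 = 0"
    "(1 + of_real \<beta>) * taylor_coeff g 2 = taylor_coeff \<psi> 1 * taylor_coeff v 1"
    "2 * (1 + 2 * of_real \<beta>) * taylor_coeff g 3 - (1 + 3 * of_real \<beta>) * (taylor_coeff g 2)\<^sup>2
      = taylor_coeff \<psi> 1 * taylor_coeff v 2 + taylor_coeff \<psi> 2 * (taylor_coeff v 1)\<^sup>2"
proof -
  have S: "g \<in> class_S"
    using g by (simp add: class_M_def)
  then have hol: "g holomorphic_on unit_disc" and g0: "g 0 = 0" "deriv g 0 = 1"
    by (auto simp: class_S_def)
  obtain v where v: "v holomorphic_on unit_disc" "v ` unit_disc \<subseteq> unit_disc" "v 0 = 0"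
    and sub: "\<And>z. z \<in> unit_disc \<Longrightarrow>
      fill_at_0 (\<lambda>z. (1 - of_real \<beta>) * (z * deriv g z / g z)
        + of_real \<beta> * (1 + z * deriv (deriv g) z / deriv g z)) z = \<psi> (v z)"
    using g unfolding class_M_def subordinate_def by blast
  note exps = holomorphic_unit_disc_has_fps_expansion
  define G V Q where "G = fps_expansion g 0" and "V = fps_expansion v 0"
    and "Q = fps_expansion \<psi> 0"
  have V0: "V $ 0 = 0"
    using v by (simp add: V_def)
  have "\<forall>z\<in>unit_disc. (1 - of_real \<beta>) * (z * (deriv g z * deriv g z))
      + of_real \<beta> * (g z * deriv g z + z * (g z * deriv (deriv g) z))
      = g z * (deriv g z * (\<psi> \<circ> v) z)"
  proof
    fix z :: complex
    assume z: "z \<in> unit_disc"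
    show "(1 - of_real \<beta>) * (z * (deriv g z * deriv g z))
      + of_real \<beta> * (g z * deriv g z + z * (g z * deriv (deriv g) z))
      = g z * (deriv g z * (\<psi> \<circ> v) z)"
    proof (cases "z = 0")
      case False
      then show ?thesis
        using sub[OF z, symmetric] class_S_nonzero[OF S z]
        by (simp add: fill_at_0_def field_simps)
    qed (simp add: g0)
  qed
  then have eq: "(1 - fps_const (of_real \<beta>)) * (fps_X * (fps_deriv G * fps_deriv G))
      + fps_const (of_real \<beta>) * (G * fps_deriv G + fps_X * (G * fps_deriv (fps_deriv G)))
      = G * (fps_deriv G * (Q oo V))"
    unfolding G_def Q_def
    by (rule has_fps_expansion_eqI)
      (intro fps_expansion_intros exps psi hol V0 exps[OF v(1), folded V_def])+
  have c: "G $ 0 = 0" "G $ 1 = 1" "G $ Suc 0 = 1" "Q $ 0 = 1" "(Q oo V) $ 0 = 1"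
    using g0 psi by (simp_all add: G_def Q_def)
  note nth = c fps_deriv_nth_small fps_X_mult_nth_small fps_mult_nth_1 fps_mult_nth_2 fps_mult_nth_3
  have E1: "(1 + of_real \<beta>) * G $ 2 = (Q oo V) $ 1"
    using arg_cong[OF eq, of "\<lambda>F. F $ 2"]
    by (simp add: nth del: One_nat_def fps_deriv_nth fps_X_mult_nth) algebra
  have E2: "(1 - of_real \<beta>) * (6 * G $ 3 + 4 * (G $ 2)\<^sup>2) + of_real \<beta> * (4 * G $ 3 + 2 * (G $ 2)\<^sup>2 + 6 * G $ 3
        + 2 * (G $ 2)\<^sup>2)
      = (Q oo V) $ 2 + 2 * G $ 2 * (Q oo V) $ 1 + 3 * G $ 3 + G $ 2 * ((Q oo V) $ 1 + 2 * G $ 2) + G $ 3"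
    using arg_cong[OF eq, of "\<lambda>F. F $ 3"]
    by (simp add: nth del: One_nat_def fps_deriv_nth fps_X_mult_nth) algebra
  have "2 * (1 + 2 * of_real \<beta>) * G $ 3 - (1 + 3 * of_real \<beta>) * (G $ 2)\<^sup>2 = (Q oo V) $ 2"
    using E2 unfolding E1[symmetric] by (simp add: power2_eq_square algebra_simps)
  then show ?thesis
    using that[OF v] E1 fps_compose_nth_small[OF V0, of Q] by (simp add: G_def Q_def V_def)
qed

text \<open>Near 0 the composition \<open>f \<circ> g\<close> is the identity, so
  \<open>F oo G = fps_X\<close>. Its coefficients of order 1, 2 and 3 determine those of
  \<open>g\<close> one after another.\<close>

lemma univalent_inverse_coeffs:
  assumes f: "f \<in> class_S" and g: "univalent_inverse f g"
  shows "taylor_coeff g 2 = - taylor_coeff f 2"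
    and "taylor_coeff g 3 = 2 * (taylor_coeff f 2)\<^sup>2 - taylor_coeff f 3"
proof -
  have hf: "f holomorphic_on unit_disc" and inj: "inj_on f unit_disc"
    and f0: "f 0 = 0" "deriv f 0 = 1"
    using f by (auto simp: class_S_def)
  have hg: "g holomorphic_on unit_disc"
    and inv: "\<forall>\<^sub>F w in nhds 0. g w = inv_into unit_disc f w"
    using g by (auto simp: univalent_inverse_def)
  have "0 \<in> f ` unit_disc"
    using f0 by (intro image_eqI[of _ _ 0]) auto
  \<comment> \<open>\<open>inv_into\<close> is a right inverse of \<open>f\<close> only on the image
    of the disc. By the open mapping theorem this image is a neighbourhood of 0.\<close>
  then have "\<forall>\<^sub>F w in nhds 0. w \<in> f ` unit_disc"
    using open_mapping_thm3[OF hf _ inj] by (intro eventually_nhds_in_open) auto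
  with inv have ev: "\<forall>\<^sub>F w in nhds 0. (f \<circ> g) w = w"
    by eventually_elim (simp add: f_inv_into_f)
  \<comment> \<open>The filter \<open>nhds 0\<close>, unlike \<open>at 0\<close>, includes the point
    0 itself, so the agreement with \<open>inv_into\<close> can be evaluated there.\<close>
  have g0: "g 0 = 0"
    using eventually_nhds_x_imp_x[OF inv] inv_into_f_f[OF inj, of 0] f0 by simp
  define F G where "F = fps_expansion f 0" and "G = fps_expansion g 0"
  note exps = hf[THEN holomorphic_unit_disc_has_fps_expansion, folded F_def]
    hg[THEN holomorphic_unit_disc_has_fps_expansion, folded G_def]
  have G0: "G $ 0 = 0" and F1: "F $ 1 = 1"
    using f0 g0 by (simp_all add: F_def G_def)
  have "(f \<circ> g) has_fps_expansion fps_X"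
    using has_fps_expansion_cong[OF ev] has_fps_expansion_fps_X by blast
  with has_fps_expansion_compose[OF exps G0] have FG: "F oo G = fps_X"
    by (rule fps_expansion_unique_complex)
  note nth = fps_compose_nth_small[OF G0, of F, unfolded FG F1]
  have G1: "G $ 1 = 1"
    using nth(1) by simp
  have G2: "G $ 2 = - F $ 2"
    using nth(2) G1 by (simp add: fps_X_nth eq_neg_iff_add_eq_0)
  then show "taylor_coeff g 2 = - taylor_coeff f 2"
    by (simp add: F_def G_def)
  have "G $ 3 + 2 * F $ 2 * G $ 2 + F $ 3 = 0"
    using nth(3) G1 by (simp add: fps_X_nth)
  then have "G $ 3 = 2 * (F $ 2)\<^sup>2 - F $ 3"
    by (simp add: G2 power2_eq_square eq_diff_eq algebra_simps)
  then show "taylor_coeff g 3 = 2 * (taylor_coeff f 2)\<^sup>2 - taylor_coeff f 3"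
    by (simp add: F_def G_def)
qed

section \<open>Elimination in the linear system\<close>

text \<open>The equations \<open>a3_u\<close> and \<open>a3_v\<close> are linear in
  \<open>a3\<close> and the square of \<open>a2\<close>, and \<sigma> is half the determinant of
  that system. Eliminating either unknown therefore leaves a multiple of \<sigma> in front of the
  other. Here \<open>p\<close> and \<open>q\<close> stand for the sums bounded in
  \<open>Schwarz_coeff_sum_bound\<close>.\<close>

lemma coefficient_system_bounds:
  fixes \<alpha> \<beta> B1 B2 D1 D2 :: real and a2 a3 u v p q :: complex
  assumes nonneg: "\<alpha> \<ge> 0" "\<beta> \<ge> 0" and pos: "B1 > 0" "D1 > 0"
    and a2_u: "(1 + 2 * of_real \<alpha>) * a2 = of_real B1 * u"
    and a3_u: "2 * (1 + 3 * of_real \<alpha>) * a3 - (1 + 2 * of_real \<alpha>) * a2\<^sup>2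
      = of_real B1 * p + (of_real B2 - of_real B1) * u\<^sup>2"
    and a2_v: "(1 + of_real \<beta>) * - a2 = of_real D1 * v"
    and a3_v: "(3 + 5 * of_real \<beta>) * a2\<^sup>2 - 2 * (1 + 2 * of_real \<beta>) * a3
      = of_real D1 * q + (of_real D2 - of_real D1) * v\<^sup>2"
    and bounds: "norm p \<le> 1" "norm q \<le> 1" "norm u \<le> 1"
  defines "\<sigma> \<equiv> 2 + 7 * \<alpha> + 3 * \<beta> + 11 * \<alpha> * \<beta>"
  defines "E \<equiv> sqrt \<bar>\<sigma> * B1\<^sup>2 * D1\<^sup>2 - (1 + 2 * \<alpha>)\<^sup>2 * (1 + 2 * \<beta>) * (B2 - B1) * D1\<^sup>2
      - (1 + \<beta>)\<^sup>2 * (1 + 3 * \<alpha>) * (D2 - D1) * B1\<^sup>2\<bar>"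
  shows "E \<noteq> 0 \<longrightarrow> norm a2 \<le> B1 * D1 * sqrt (B1 * (1 + 2 * \<beta>) + D1 * (1 + 3 * \<alpha>)) / E"
    and "2 * \<sigma> * norm a3 \<le> B1 * (3 + 5 * \<beta>) + D1 * (1 + 2 * \<alpha>) + (3 + 5 * \<beta>) * \<bar>B2 - B1\<bar>
      + (1 + \<beta>)\<^sup>2 * B1\<^sup>2 * \<bar>D2 - D1\<bar> / (D1\<^sup>2 * (1 + 2 * \<alpha>))"
proof -
  define K where "K = \<sigma> * B1\<^sup>2 * D1\<^sup>2 - (1 + 2 * \<alpha>)\<^sup>2 * (1 + 2 * \<beta>) * (B2 - B1) * D1\<^sup>2
    - (1 + \<beta>)\<^sup>2 * (1 + 3 * \<alpha>) * (D2 - D1) * B1\<^sup>2"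
  define M where "M = B1 * (1 + 2 * \<beta>) + D1 * (1 + 3 * \<alpha>)"
  have E: "E\<^sup>2 = \<bar>K\<bar>" "E \<ge> 0"
    by (simp_all add: E_def K_def)
  have M: "M \<ge> 0"
    using nonneg pos by (simp add: M_def)
  have u2: "(of_real B1 * u)\<^sup>2 = ((1 + 2 * of_real \<alpha>) * a2)\<^sup>2"
    and v2: "(of_real D1 * v)\<^sup>2 = ((1 + of_real \<beta>) * a2)\<^sup>2"
    by (simp_all flip: a2_u a2_v)
  \<comment> \<open>The weights \<open>1 + 2 * \<beta>\<close> and \<open>1 + 3 * \<alpha>\<close>
    are chosen to cancel \<open>a3\<close>.\<close>
  have "of_real \<sigma> * a2\<^sup>2 =
      (1 + 2 * of_real \<beta>) * (2 * (1 + 3 * of_real \<alpha>) * a3 - (1 + 2 * of_real \<alpha>) * a2\<^sup>2)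
      + (1 + 3 * of_real \<alpha>) * ((3 + 5 * of_real \<beta>) * a2\<^sup>2 - 2 * (1 + 2 * of_real \<beta>) * a3)"
    by (simp add: \<sigma>_def algebra_simps)
  also note a3_u
  also note a3_v
  finally have sum: "of_real \<sigma> * a2\<^sup>2 =
      (1 + 2 * of_real \<beta>) * (of_real B1 * p + (of_real B2 - of_real B1) * u\<^sup>2)
      + (1 + 3 * of_real \<alpha>) * (of_real D1 * q + (of_real D2 - of_real D1) * v\<^sup>2)" .
  \<comment> \<open>By \<open>u2\<close> and \<open>v2\<close> the squares of \<open>u\<close> and
    \<open>v\<close> are themselves multiples of the square of \<open>a2\<close>. Moving them to the
    left turns \<sigma> into \<open>K\<close>, after multiplication by the squares of
    \<open>B1\<close> and \<open>D1\<close> to avoid fractions. Only \<open>p\<close> and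
    \<open>q\<close> remain on the right.\<close>
  have "of_real K * a2\<^sup>2 = of_real (B1\<^sup>2 * D1\<^sup>2) * (of_real \<sigma> * a2\<^sup>2)
      - (1 + 2 * of_real \<beta>) * (of_real B2 - of_real B1) * (of_real D1)\<^sup>2 * ((1 + 2 * of_real \<alpha>) * a2)\<^sup>2
      - (1 + 3 * of_real \<alpha>) * (of_real D2 - of_real D1) * (of_real B1)\<^sup>2 * ((1 + of_real \<beta>) * a2)\<^sup>2"
    by (simp add: K_def power_mult_distrib left_diff_distrib right_diff_distrib mult_ac)
  also have "\<dots> = of_real (B1\<^sup>2 * D1\<^sup>2)
      * (of_real ((1 + 2 * \<beta>) * B1) * p + of_real ((1 + 3 * \<alpha>) * D1) * q)"
    unfolding u2[symmetric] v2[symmetric] sum by (simp add: power_mult_distrib algebra_simps)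
  finally have "of_real K * a2\<^sup>2 = of_real (B1\<^sup>2 * D1\<^sup>2)
      * (of_real ((1 + 2 * \<beta>) * B1) * p + of_real ((1 + 3 * \<alpha>) * D1) * q)" .
  from arg_cong[OF this, of norm]
  have "E\<^sup>2 * (norm a2)\<^sup>2 = B1\<^sup>2 * D1\<^sup>2
      * norm (of_real ((1 + 2 * \<beta>) * B1) * p + of_real ((1 + 3 * \<alpha>) * D1) * q)"
    unfolding E norm_mult norm_of_real norm_power by (simp add: abs_mult)
  also have "\<dots> \<le> B1\<^sup>2 * D1\<^sup>2 * M"
  proof (intro mult_left_mono order_trans[OF norm_triangle_ineq])
    have "norm (of_real ((1 + 2 * \<beta>) * B1) * p) \<le> (1 + 2 * \<beta>) * B1"
      "norm (of_real ((1 + 3 * \<alpha>) * D1) * q) \<le> (1 + 3 * \<alpha>) * D1"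
      unfolding norm_mult norm_of_real using nonneg pos bounds
      by (simp_all add: abs_mult mult_left_le)
    then show "norm (of_real ((1 + 2 * \<beta>) * B1) * p) + norm (of_real ((1 + 3 * \<alpha>) * D1) * q) \<le> M"
      by (simp add: M_def algebra_simps)
  qed simp
  finally have "(E * norm a2)\<^sup>2 \<le> (B1 * D1 * sqrt M)\<^sup>2"
    using M by (simp add: power_mult_distrib)
  then have "E * norm a2 \<le> B1 * D1 * sqrt M"
    by (rule power2_le_imp_le) (use pos M in simp)
  then show "E \<noteq> 0 \<longrightarrow> norm a2 \<le> B1 * D1 * sqrt (B1 * (1 + 2 * \<beta>) + D1 * (1 + 3 * \<alpha>)) / E"
    using E(2) by (simp add: M_def pos_le_divide_eq mult.commute[of E])
  define R where "R = (1 + \<beta>)\<^sup>2 * B1\<^sup>2 * \<bar>D2 - D1\<bar> / (D1\<^sup>2 * (1 + 2 * \<alpha>))"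
  \<comment> \<open>Both \<open>u\<close> and \<open>v\<close> are proportional to
    \<open>a2\<close>, so the bound on \<open>u\<close> yields one on \<open>v\<close>. Squaring it
    puts the square of \<open>1 + 2 * \<alpha>\<close> in a denominator, and the weight of
    \<open>a3_v\<close> in the elimination below cancels one factor; this is the form of
    \<open>R\<close>.\<close>
  have v_u: "(1 + 2 * \<alpha>) * D1 * norm v = (1 + \<beta>) * B1 * norm u"
  proof -
    have n: "norm (1 + 2 * complex_of_real \<alpha>) = 1 + 2 * \<alpha>"
      "norm (1 + complex_of_real \<beta>) = 1 + \<beta>"
      using nonneg norm_of_real[of "1 + 2 * \<alpha>", where ?'a = complex]
        norm_of_real[of "1 + \<beta>", where ?'a = complex]
      by (simp_all del: norm_of_real)
    have eqs: "B1 * norm u = (1 + 2 * \<alpha>) * norm a2" "D1 * norm v = (1 + \<beta>) * norm a2"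
      using arg_cong[OF a2_u, of norm] arg_cong[OF a2_v, of norm] pos
      by (simp_all add: norm_mult n)
    show ?thesis
      by (simp only: mult.assoc eqs) (simp only: mult.left_commute)
  qed
  have "norm v = (1 + \<beta>) * B1 * norm u / ((1 + 2 * \<alpha>) * D1)"
    using v_u nonneg pos by (simp add: nonzero_eq_divide_eq mult_ac)
  also have "\<dots> \<le> (1 + \<beta>) * B1 / ((1 + 2 * \<alpha>) * D1)"
    using nonneg pos bounds(3) by (intro divide_right_mono mult_left_le) auto
  finally have "(norm v)\<^sup>2 \<le> ((1 + \<beta>) * B1 / ((1 + 2 * \<alpha>) * D1))\<^sup>2"
    by (simp add: power_mono)
  then have "(1 + 2 * \<alpha>) * (\<bar>D2 - D1\<bar> * (norm v)\<^sup>2)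
      \<le> (1 + 2 * \<alpha>) * (\<bar>D2 - D1\<bar> * ((1 + \<beta>) * B1 / ((1 + 2 * \<alpha>) * D1))\<^sup>2)"
    using nonneg by (intro mult_left_mono) auto
  also have "\<dots> = R"
    using nonneg pos
    by (simp add: R_def power_divide power_mult_distrib power2_eq_square[of "1 + 2 * \<alpha>"])
      (simp only: mult_ac)
  finally have R: "(1 + 2 * \<alpha>) * (\<bar>D2 - D1\<bar> * (norm v)\<^sup>2) \<le> R" .
  \<comment> \<open>Now the weights \<open>3 + 5 * \<beta>\<close> and
    \<open>1 + 2 * \<alpha>\<close> cancel the square of \<open>a2\<close>.\<close>
  have "of_real (2 * \<sigma>) * a3 =
      (3 + 5 * of_real \<beta>) * (2 * (1 + 3 * of_real \<alpha>) * a3 - (1 + 2 * of_real \<alpha>) * a2\<^sup>2)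
      + (1 + 2 * of_real \<alpha>) * ((3 + 5 * of_real \<beta>) * a2\<^sup>2 - 2 * (1 + 2 * of_real \<beta>) * a3)"
    by (simp add: \<sigma>_def algebra_simps)
  also have "\<dots> = of_real (3 + 5 * \<beta>) * (of_real B1 * p + of_real (B2 - B1) * u\<^sup>2)
      + of_real (1 + 2 * \<alpha>) * (of_real D1 * q + of_real (D2 - D1) * v\<^sup>2)"
    unfolding a3_u a3_v by simp
  finally have "norm (of_real (2 * \<sigma>) * a3)
      \<le> norm (of_real (3 + 5 * \<beta>) * (of_real B1 * p + of_real (B2 - B1) * u\<^sup>2))
      + norm (of_real (1 + 2 * \<alpha>) * (of_real D1 * q + of_real (D2 - D1) * v\<^sup>2))"
    by (simp only: norm_triangle_ineq)
  also have "norm (of_real (2 * \<sigma>) * a3) = 2 * \<sigma> * norm a3"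
    unfolding norm_mult norm_of_real using nonneg by (simp add: \<sigma>_def)
  also have "norm (of_real (3 + 5 * \<beta>) * (of_real B1 * p + of_real (B2 - B1) * u\<^sup>2))
      \<le> (3 + 5 * \<beta>) * (B1 + \<bar>B2 - B1\<bar>)"
  proof -
    have "norm (of_real B1 * p + of_real (B2 - B1) * u\<^sup>2) \<le> B1 * norm p + \<bar>B2 - B1\<bar> * (norm u)\<^sup>2"
      by (rule order_trans[OF norm_triangle_ineq])
        (use pos in \<open>simp add: norm_mult norm_power del: of_real_diff\<close>)
    also have "\<dots> \<le> B1 + \<bar>B2 - B1\<bar>"
      using pos bounds by (intro add_mono mult_left_le) (auto simp: abs_square_le_1)
    finally show ?thesis
      unfolding norm_mult norm_of_real using nonneg by (simp add: mult_left_mono)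
  qed
  also have "norm (of_real (1 + 2 * \<alpha>) * (of_real D1 * q + of_real (D2 - D1) * v\<^sup>2))
      \<le> (1 + 2 * \<alpha>) * D1 + R"
  proof -
    have "norm (of_real D1 * q + of_real (D2 - D1) * v\<^sup>2) \<le> D1 * norm q + \<bar>D2 - D1\<bar> * (norm v)\<^sup>2"
      by (rule order_trans[OF norm_triangle_ineq])
        (use pos in \<open>simp add: norm_mult norm_power del: of_real_diff\<close>)
    also have "\<dots> \<le> D1 + \<bar>D2 - D1\<bar> * (norm v)\<^sup>2"
      using pos bounds by (simp add: mult_left_le)
    finally have "norm (of_real (1 + 2 * \<alpha>) * (of_real D1 * q + of_real (D2 - D1) * v\<^sup>2))
        \<le> (1 + 2 * \<alpha>) * (D1 + \<bar>D2 - D1\<bar> * (norm v)\<^sup>2)"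
      unfolding norm_mult norm_of_real using nonneg by (simp add: mult_left_mono)
    then show ?thesis
      using R by (simp only: distrib_left)
  qed
  finally show "2 * \<sigma> * norm a3 \<le> B1 * (3 + 5 * \<beta>) + D1 * (1 + 2 * \<alpha>) + (3 + 5 * \<beta>) * \<bar>B2 - B1\<bar>
      + (1 + \<beta>)\<^sup>2 * B1\<^sup>2 * \<bar>D2 - D1\<bar> / (D1\<^sup>2 * (1 + 2 * \<alpha>))"
    by (simp add: R_def algebra_simps)
qed

theorem theorem2p2:
  fixes \<alpha> \<beta> \<sigma> B1 B2 D1 D2 :: real
    and \<phi> \<psi> f g :: "complex \<Rightarrow> complex"
  assumes "\<alpha> \<ge> 0" and "\<beta> \<ge> 0"
    and "\<phi> holomorphic_on unit_disc"
    and "taylor_coeff \<phi> 0 = 1"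
    and "taylor_coeff \<phi> 1 = of_real B1"
    and "taylor_coeff \<phi> 2 = of_real B2"
    and "B1 > 0"
    and "\<psi> holomorphic_on unit_disc"
    and "taylor_coeff \<psi> 0 = 1"
    and "taylor_coeff \<psi> 1 = of_real D1"
    and "taylor_coeff \<psi> 2 = of_real D2"
    and "D1 > 0"
    and "bi_univalent f"
    and "univalent_inverse f g"
    and "f \<in> class_P \<alpha> \<phi>"
    and "g \<in> class_M \<beta> \<psi>"
    and "\<sigma> = 2 + 7 * \<alpha> + 3 * \<beta> + 11 * \<alpha> * \<beta>"
  shows "(let E = sqrt \<bar>\<sigma> * B1\<^sup>2 * D1\<^sup>2
                       - (1 + 2 * \<alpha>)\<^sup>2 * (1 + 2 * \<beta>) * (B2 - B1) * D1\<^sup>2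
                       - (1 + \<beta>)\<^sup>2 * (1 + 3 * \<alpha>) * (D2 - D1) * B1\<^sup>2\<bar>
          in E \<noteq> 0 \<longrightarrow>
             norm (taylor_coeff f 2)
               \<le> B1 * D1 * sqrt (B1 * (1 + 2 * \<beta>) + D1 * (1 + 3 * \<alpha>)) / E)
       \<and> 2 * \<sigma> * norm (taylor_coeff f 3)
           \<le> B1 * (3 + 5 * \<beta>) + D1 * (1 + 2 * \<alpha>) + (3 + 5 * \<beta>) * \<bar>B2 - B1\<bar>
             + (1 + \<beta>)\<^sup>2 * B1\<^sup>2 * \<bar>D2 - D1\<bar> / (D1\<^sup>2 * (1 + 2 * \<alpha>))"
proof -
  have phi0: "\<phi> 0 = 1" and psi0: "\<psi> 0 = 1"
    using assms(4,9) by simp_all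
  have S: "f \<in> class_S"
    using assms(13) by (simp add: bi_univalent_def)
  obtain u where u: "u holomorphic_on unit_disc" "u ` unit_disc \<subseteq> unit_disc" "u 0 = 0"
    and F1: "(1 + 2 * of_real \<alpha>) * taylor_coeff f 2 = B1 * taylor_coeff u 1"
    and F2: "2 * (1 + 3 * of_real \<alpha>) * taylor_coeff f 3 - (1 + 2 * of_real \<alpha>) * (taylor_coeff f 2)\<^sup>2
      = B1 * taylor_coeff u 2 + B2 * (taylor_coeff u 1)\<^sup>2"
    using class_P_coeffs[OF assms(15,3) phi0] unfolding assms(5,6) by metis
  obtain v where v: "v holomorphic_on unit_disc" "v ` unit_disc \<subseteq> unit_disc" "v 0 = 0"
    and G1: "(1 + of_real \<beta>) * taylor_coeff g 2 = D1 * taylor_coeff v 1"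
    and G2: "2 * (1 + 2 * of_real \<beta>) * taylor_coeff g 3 - (1 + 3 * of_real \<beta>) * (taylor_coeff g 2)\<^sup>2
      = D1 * taylor_coeff v 2 + D2 * (taylor_coeff v 1)\<^sup>2"
    using class_M_coeffs[OF assms(16,8) psi0] unfolding assms(10,11) by metis
  note inv = univalent_inverse_coeffs[OF S assms(14)]
  define p q where "p = taylor_coeff u 2 + (taylor_coeff u 1)\<^sup>2"
    and "q = taylor_coeff v 2 + (taylor_coeff v 1)\<^sup>2"
  have "norm p \<le> 1" "norm q \<le> 1" "norm (taylor_coeff u 1) \<le> 1"
    unfolding p_def q_def using u v Schwarz_coeff_sum_bound Schwarz_coeff_bounds(1) by blast+
  moreover have "B1 * taylor_coeff u 2 + B2 * (taylor_coeff u 1)\<^sup>2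
      = B1 * p + (of_real B2 - of_real B1) * (taylor_coeff u 1)\<^sup>2"
    "D1 * taylor_coeff v 2 + D2 * (taylor_coeff v 1)\<^sup>2
      = D1 * q + (of_real D2 - of_real D1) * (taylor_coeff v 1)\<^sup>2"
    by (simp_all add: p_def q_def algebra_simps)
  \<comment> \<open>The third coefficient of \<open>g\<close> contributes
    \<open>4 * (1 + 2 * \<beta>)\<close> to the square of the second coefficient of
    \<open>f\<close>; subtracting \<open>1 + 3 * \<beta>\<close> leaves
    \<open>3 + 5 * \<beta>\<close>.\<close>
  moreover have "2 * (1 + 2 * of_real \<beta>) * taylor_coeff g 3 - (1 + 3 * of_real \<beta>) * (taylor_coeff g 2)\<^sup>2
      = (3 + 5 * of_real \<beta>) * (taylor_coeff f 2)\<^sup>2 - 2 * (1 + 2 * of_real \<beta>) * taylor_coeff f 3"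
    unfolding inv by (simp add: algebra_simps)
  ultimately show ?thesis
    using coefficient_system_bounds[OF assms(1,2,7,12), of "taylor_coeff f 2" "taylor_coeff u 1"
        "taylor_coeff f 3" p B2 "taylor_coeff v 1" q D2] F1 F2 G1 G2
    by (simp add: Let_def inv assms(17))
qed

end
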